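(* There is an absolute constant $\alpha>0$ such that for every $c\ge1$, every property $\mathcal{P}$ of black-white $n\times n$ images that has a $c$-sparse boundary is $\delta$-earthmover resilient with $\delta(\epsilon)=\alpha\epsilon^2/c^2$ for every $\epsilon\in(0,1)$.
   Context: A black-white $n\times n$ image is a function $\mathcal{I}\colon[n]\times[n]\to\{\text{black},\text{white}\}$; two pixels are neighbors if they agree in one coordinate and differ by one in the other. The boundary of $\mathcal{I}$ is the set of black pixels having a white neighbor; it is $c$-sparse if it has at most $cn$ pixels. A property $\mathcal{P}$ (a set of images) has a $c$-sparse boundary if every image in $\mathcal{P}$ has a $c$-sparse boundary. Hamming distance: $d_H$ is the fraction of differing pixels; $\mathcal{I}$ is $\epsilon$-close to $\mathcal{P}$ if some $n\times n$ image of $\mathcal{P}$ differs from it in at most an $\epsilon$ fraction of pixels. Earthmover distance: images are identified with ordered graphs on $[2n]$ (rows $1,\dots,n$, columns $n+1,\dots,2n$; pair $\{x,n+y\}$ colored $\mathcal{I}(x,y)$, pairs of two rows or two columns colored by a special symbol); a basic move swaps two consecutive vertices of $[2n]$; $D_e$ is the minimum number of basic moves transforming one into the other ($+\infty$ if impossible) and $d_e=D_e/\binom{2n}{2}$. $\mathcal{P}$ is $\delta$-earthmover resilient if for every $\epsilon\in(0,1)$, every $\mathcal{I}\in\mathcal{P}$ and every $\mathcal{I}'$ with $d_e(\mathcal{I},\mathcal{I}')\le\delta(\epsilon)$, $\mathcal{I}'$ is $\epsilon$-close to $\mathcal{P}$. *)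

theory Defs
  imports
    Complex_Main
    "HOL-Library.FuncSet"
    "HOL-Library.Extended_Real"
    "HOL-Combinatorics.Transposition"
begin

datatype color = Black | White

type_synonym pixel = "nat \<times> nat"
type_synonym img = "pixel \<Rightarrow> color"

definition grid :: "nat \<Rightarrow> pixel set" where
  "grid n = {1..n} \<times> {1..n}"

(* Extensional functions, so that equality of images is agreement on the grid. *)
definition images :: "nat \<Rightarrow> img set" where
  "images n = grid n \<rightarrow>\<^sub>E UNIV"

(* A property may contain images of every size; P n is its set of n x n members. *)
type_synonym property = "nat \<Rightarrow> img set"

definition is_property :: "property \<Rightarrow> bool" where
  "is_property P \<longleftrightarrow> (\<forall>n\<ge>1. P n \<subseteq> images n)"


definition differ_by_one :: "nat \<Rightarrow> nat \<Rightarrow> bool" where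
  "differ_by_one a b \<longleftrightarrow> a = Suc b \<or> b = Suc a"

definition neighbors :: "pixel \<Rightarrow> pixel \<Rightarrow> bool" where
  "neighbors p q \<longleftrightarrow>
     fst p = fst q \<and> differ_by_one (snd p) (snd q) \<or>
     snd p = snd q \<and> differ_by_one (fst p) (fst q)"

definition boundary :: "nat \<Rightarrow> img \<Rightarrow> pixel set" where
  "boundary n I = {p \<in> grid n. I p = Black \<and> (\<exists>q \<in> grid n. neighbors p q \<and> I q = White)}"

definition sparse_boundary :: "real \<Rightarrow> nat \<Rightarrow> img \<Rightarrow> bool" where
  "sparse_boundary c n I \<longleftrightarrow> real (card (boundary n I)) \<le> c * real n"

definition property_sparse_boundary :: "real \<Rightarrow> property \<Rightarrow> bool" where
  "property_sparse_boundary c P \<longleftrightarrow> (\<forall>n\<ge>1. \<forall>I \<in> P n. sparse_boundary c n I)"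


definition hamming_dist :: "nat \<Rightarrow> img \<Rightarrow> img \<Rightarrow> real" where
  "hamming_dist n I J = real (card {p \<in> grid n. I p \<noteq> J p}) / real (n ^ 2)"

definition close_to :: "real \<Rightarrow> nat \<Rightarrow> img \<Rightarrow> property \<Rightarrow> bool" where
  "close_to \<epsilon> n I P \<longleftrightarrow> (\<exists>J \<in> P n. hamming_dist n I J \<le> \<epsilon>)"


datatype edge_color = Special | Pixel color

(* An edge-colored ordered complete graph on {1..m}: a coloring of the 2-subsets of {1..m},
   extended by undefined to all other sets. *)
type_synonym ograph = "nat set \<Rightarrow> edge_color"

definition pairs :: "nat \<Rightarrow> nat set set" where
  "pairs m = {e. e \<subseteq> {1..m} \<and> card e = 2}"

(* The condition holds iff e = {x, n + y} with x = Min e and y = Max e - n both in {1..n}. *)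
definition image_graph :: "nat \<Rightarrow> img \<Rightarrow> ograph" where
  "image_graph n I = (\<lambda>e \<in> pairs (2 * n).
     if Min e \<le> n \<and> n < Max e then Pixel (I (Min e, Max e - n)) else Special)"

(* The moves range over all edge-colored graphs on {1..m}: between two image graphs,
   the intermediate graphs need not be image graphs. *)
definition basic_move :: "nat \<Rightarrow> (ograph \<times> ograph) set" where
  "basic_move m = {(F, G). \<exists>i. 1 \<le> i \<and> i < m \<and>
     G = (\<lambda>e. F (Transposition.transpose i (Suc i) ` e))}"

(* The infimum of the empty set is \<infinity>. *)
definition D_e :: "nat \<Rightarrow> img \<Rightarrow> img \<Rightarrow> enat" where
  "D_e n I J = (INF k \<in> {k. (image_graph n I, image_graph n J) \<in> basic_move (2 * n) ^^ k}. enat k)"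

definition d_e :: "nat \<Rightarrow> img \<Rightarrow> img \<Rightarrow> ereal" where
  "d_e n I J = ereal_of_enat (D_e n I J) / ereal (real ((2 * n) choose 2))"

definition earthmover_resilient :: "(real \<Rightarrow> real) \<Rightarrow> property \<Rightarrow> bool" where
  "earthmover_resilient \<delta> P \<longleftrightarrow>
     (\<forall>\<epsilon>. 0 < \<epsilon> \<and> \<epsilon> < 1 \<longrightarrow>
       (\<forall>n\<ge>1. \<forall>I \<in> P n. \<forall>I' \<in> images n. d_e n I I' \<le> ereal (\<delta> \<epsilon>) \<longrightarrow> close_to \<epsilon> n I' P))"

end

theory Submission
  imports Defs "HOL-Combinatorics.Permutations"
begin

text \<open>
  The image \<open>I\<close> itself is the member of \<open>P\<close> close to \<open>I'\<close>. A sequence of \<open>k\<close> basic moves composes to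
  a permutation \<open>\<sigma>\<close> of the \<open>2n\<close> vertices with at most \<open>k\<close> inversions. If \<open>u\<close> points jump upwards over
  some threshold, then \<open>u\<close> points jump downwards over it and all \<open>u\<^sup>2\<close> pairs are inversions, so every
  threshold is crossed at most \<open>2 sqrt k\<close> times. The special colour forces \<open>\<sigma>\<close> either to exchange
  rows and columns, which costs \<open>n\<^sup>2\<close> inversions, or to preserve both. In the latter case a pixel
  changes colour only if its vertical or horizontal displacement crosses a colour change of \<open>I\<close>;
  there are at most \<open>2cn\<close> colour changes in each direction, hence at most \<open>8cn sqrt k\<close> pixels change.
\<close>

section \<open>Inversions\<close>

definition inversions :: "(nat \<Rightarrow> nat) \<Rightarrow> (nat \<times> nat) set" where
  "inversions s = {(a, b). a < b \<and> s b < s a}"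

text \<open>Swapping the adjacent values \<open>i\<close> and \<open>Suc i\<close> keeps the
  relative order of any other two values, so the only pair that can become inverted is the one
  carrying exactly these values.\<close>

lemma inversions_transpose_comp_subset:
  assumes "bij s"
  shows "inversions (transpose i (Suc i) \<circ> s) \<subseteq> insert (inv s i, inv s (Suc i)) (inversions s)"
proof
  fix p assume p: "p \<in> inversions (transpose i (Suc i) \<circ> s)"
  obtain a b where ab: "p = (a, b)" by force
  have lt: "a < b" "transpose i (Suc i) (s b) < transpose i (Suc i) (s a)"
    using p ab by (auto simp: inversions_def)
  have ne: "s a \<noteq> s b" using lt assms by (metis less_irrefl)
  show "p \<in> insert (inv s i, inv s (Suc i)) (inversions s)"
  proof (cases "s b < s a")
    case True
    then show ?thesis using lt ab by (auto simp: inversions_def)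
  next
    case False
    then have "s a = i" "s b = Suc i"
      using lt ne by (auto simp: transpose_def split: if_splits)
    then show ?thesis using assms ab by (metis bij_inv_eq_iff insertI1)
  qed
qed

text \<open>Each move contributes one adjacent transposition, hence at most one new inversion. Since
  \<open>inversions\<close> ranges over all naturals, finiteness is carried through the induction so
  that the cardinality bound has content.\<close>

lemma basic_moves_permutation:
  assumes "(F, G) \<in> basic_move m ^^ k"
  obtains s where "s permutes {1..m}" "finite (inversions s)" "card (inversions s) \<le> k"
    "G = (\<lambda>e. F (s ` e))"
proof -
  have "\<exists>s. s permutes {1..m} \<and> finite (inversions s) \<and> card (inversions s) \<le> k \<and> G = (\<lambda>e. F (s ` e))"
    using assms
  proof (induction k arbitrary: F)
    case 0
    have "inversions (\<lambda>x. x) = {}" by (auto simp: inversions_def)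
    moreover have "(\<lambda>x. x) permutes {1..m}" by (simp add: permutes_def)
    ultimately show ?case using 0 by (intro exI[of _ "\<lambda>x. x"]) auto
  next
    case (Suc k)
    \<comment> \<open>Moves act on the argument of the colouring, so the first move becomes the
      outermost factor of the composition. Peeling it off gives
      \<open>transpose i (Suc i) \<circ> s\<close>, where adjacent values are swapped.\<close>
    then obtain H where H: "(F, H) \<in> basic_move m" "(H, G) \<in> basic_move m ^^ k"
      by (meson relpow_Suc_D2)
    obtain i where i: "1 \<le> i" "i < m" "H = (\<lambda>e. F (transpose i (Suc i) ` e))"
      using H(1) by (auto simp: basic_move_def)
    obtain s where s: "s permutes {1..m}" "finite (inversions s)" "card (inversions s) \<le> k"
      "G = (\<lambda>e. H (s ` e))" using Suc.IH[OF H(2)] by blast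
    let ?t = "transpose i (Suc i) \<circ> s"
    have "?t permutes {1..m}"
      using i s(1) by (intro permutes_compose permutes_swap_id) auto
    moreover have sub: "inversions ?t \<subseteq> insert (inv s i, inv s (Suc i)) (inversions s)"
      using s(1) by (intro inversions_transpose_comp_subset) (rule permutes_bij)
    moreover have "finite (inversions ?t)"
      using sub s(2) by (meson finite.insertI finite_subset)
    moreover have "card (inversions ?t) \<le> Suc k"
    proof -
      have "card (inversions ?t) \<le> card (insert (inv s i, inv s (Suc i)) (inversions s))"
        using s(2) by (intro card_mono sub) simp
      also have "\<dots> \<le> Suc (card (inversions s))" using s(2) by (simp add: card_insert_if)
      finally show ?thesis using s(3) by linarith
    qed
    moreover have "G = (\<lambda>e. F (?t ` e))" using s(4) i(3) by (simp add: image_comp)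
    ultimately show ?case by blast
  qed
  then show ?thesis using that by blast
qed

section \<open>Threshold crossings of a permutation\<close>

text \<open>The points starting at or below \<open>i\<close> and those ending there are equally
  many, since \<open>s\<close> maps the latter onto the former. The two kinds of crossing are the
  two differences of these sets.\<close>

lemma card_crossings_up_eq_down:
  fixes s :: "nat \<Rightarrow> nat"
  assumes "s permutes S" "finite S"
  shows "card {x \<in> S. x \<le> i \<and> i < s x} = card {x \<in> S. s x \<le> i \<and> i < x}"
proof -
  let ?A = "{x \<in> S. x \<le> i}" and ?B = "{x \<in> S. s x \<le> i}"
  have "s ` ?B = ?A"
  proof
    show "s ` ?B \<subseteq> ?A" using assms(1) by (auto simp: permutes_in_image)
    show "?A \<subseteq> s ` ?B"
    proof
      fix y assume y: "y \<in> ?A"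
      then obtain x where "x \<in> S" "y = s x" using permutes_image[OF assms(1)] by auto
      then show "y \<in> s ` ?B" using y by auto
    qed
  qed
  then have c: "card ?A = card ?B"
    using permutes_inj_on[OF assms(1), of ?B] by (metis card_image)
  have "{x \<in> S. x \<le> i \<and> i < s x} = ?A - ?B" "{x \<in> S. s x \<le> i \<and> i < x} = ?B - ?A" by auto
  then show ?thesis
    using c assms(2) by (simp add: card_Diff_subset_Int Int_commute)
qed

lemma crossings_up_squared_le_inversions:
  fixes s :: "nat \<Rightarrow> nat"
  assumes "s permutes S" "finite S" "finite (inversions s)"
  shows "(card {x \<in> S. x \<le> i \<and> i < s x})\<^sup>2 \<le> card (inversions s)"
proof -
  let ?U = "{x \<in> S. x \<le> i \<and> i < s x}" and ?D = "{x \<in> S. s x \<le> i \<and> i < x}"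
  have "?U \<times> ?D \<subseteq> inversions s" by (auto simp: inversions_def)
  then have "card (?U \<times> ?D) \<le> card (inversions s)" using assms(3) card_mono by blast
  then show ?thesis
    using card_crossings_up_eq_down[OF assms(1,2), of i]
    by (simp add: card_cartesian_product power2_eq_square)
qed

text \<open>The threshold lies between \<open>i\<close> and \<open>Suc i\<close>, to be matched with
  a colour change between these two coordinates.\<close>

definition crossings :: "nat set \<Rightarrow> (nat \<Rightarrow> nat) \<Rightarrow> nat \<Rightarrow> nat set" where
  "crossings S s i = {x \<in> S. x \<le> i \<and> i < s x \<or> s x \<le> i \<and> i < x}"

lemma card_crossings_le:
  assumes "s permutes S" "finite S" "finite (inversions s)" "card (inversions s) \<le> k"
  shows "real (card (crossings S s i)) \<le> 2 * sqrt k"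
proof -
  let ?U = "{x \<in> S. x \<le> i \<and> i < s x}" and ?D = "{x \<in> S. s x \<le> i \<and> i < x}"
  have "crossings S s i = ?U \<union> ?D" by (auto simp: crossings_def)
  then have "card (crossings S s i) \<le> 2 * card ?U"
    using card_Un_le[of ?U ?D] card_crossings_up_eq_down[OF assms(1,2), of i] by simp
  moreover have "real (card ?U) \<le> sqrt k"
    using crossings_up_squared_le_inversions[OF assms(1-3), of i] assms(4)
    by (intro real_le_rsqrt) (metis of_nat_le_iff of_nat_power order_trans)
  ultimately show ?thesis by linarith
qed

section \<open>Colour changes\<close>

text \<open>Only changes along the first coordinate are recorded, by their smaller endpoint; the
  other direction is obtained by applying this to \<open>I \<circ> prod.swap\<close>.\<close>

definition color_changes :: "nat \<Rightarrow> img \<Rightarrow> pixel set" where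
  "color_changes n I = {(i, y). 1 \<le> i \<and> i < n \<and> y \<in> {1..n} \<and> I (i, y) \<noteq> I (Suc i, y)}"

lemma finite_grid [simp]: "finite (grid n)"
  by (simp add: grid_def)

lemma finite_boundary [simp]: "finite (boundary n I)"
  by (simp add: boundary_def)

lemma color_changes_subset_grid: "color_changes n I \<subseteq> grid n"
  by (auto simp: color_changes_def grid_def)

text \<open>One of the two pixels of a colour change is black and thus on the boundary. It is either
  the recorded endpoint or its successor, so each boundary pixel accounts for at most two
  changes.\<close>

lemma card_color_changes_le: "card (color_changes n I) \<le> 2 * card (boundary n I)"
proof -
  let ?f = "\<lambda>(x, y). (x - 1, y) :: pixel"
  have "color_changes n I \<subseteq> boundary n I \<union> ?f ` boundary n I"
  proof
    fix p assume "p \<in> color_changes n I"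
    then obtain i y where p: "p = (i, y)" "1 \<le> i" "i < n" "y \<in> {1..n}" "I (i, y) \<noteq> I (Suc i, y)"
      by (auto simp: color_changes_def)
    have g: "(i, y) \<in> grid n" "(Suc i, y) \<in> grid n" using p by (auto simp: grid_def)
    have nb: "neighbors (i, y) (Suc i, y)" "neighbors (Suc i, y) (i, y)"
      by (auto simp: neighbors_def differ_by_one_def)
    show "p \<in> boundary n I \<union> ?f ` boundary n I"
    proof (cases "I (i, y)")
      case Black
      then have "I (Suc i, y) = White" using p(5) by (metis color.exhaust)
      then show ?thesis using Black g nb p(1) by (auto simp: boundary_def)
    next
      case White
      then have "I (Suc i, y) = Black" using p(5) by (metis color.exhaust)
      then have "(Suc i, y) \<in> boundary n I" using White g nb by (auto simp: boundary_def)
      then have "?f (Suc i, y) \<in> ?f ` boundary n I" by (rule imageI)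
      then show ?thesis using p(1) by simp
    qed
  qed
  then have "card (color_changes n I) \<le> card (boundary n I \<union> ?f ` boundary n I)"
    by (intro card_mono) auto
  also have "\<dots> \<le> card (boundary n I) + card (?f ` boundary n I)" by (rule card_Un_le)
  also have "\<dots> \<le> 2 * card (boundary n I)" using card_image_le[of "boundary n I" ?f] by simp
  finally show ?thesis .
qed

lemma boundary_swap: "boundary n (I \<circ> prod.swap) = prod.swap ` boundary n I"
proof -
  have 1: "p \<in> boundary n (I \<circ> prod.swap) \<longleftrightarrow> prod.swap p \<in> boundary n I" for p
    by (cases p) (auto simp: boundary_def grid_def neighbors_def)
  show ?thesis
  proof (intro set_eqI)
    fix p show "p \<in> boundary n (I \<circ> prod.swap) \<longleftrightarrow> p \<in> prod.swap ` boundary n I"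
      by (cases p) (force simp: 1 image_iff)
  qed
qed

section \<open>Pixels changed by a displacement\<close>

lemma color_change_between:
  fixes g :: "nat \<Rightarrow> 'a"
  assumes "a < b" "g a \<noteq> g b"
  obtains i where "a \<le> i" "i < b" "g i \<noteq> g (Suc i)"
proof -
  have "\<exists>i. a \<le> i \<and> i < b \<and> g i \<noteq> g (Suc i)"
  proof (rule ccontr)
    assume *: "\<not> ?thesis"
    have "g j = g a" if "a \<le> j" "j \<le> b" for j
      using that by (induction j rule: dec_induct) (use * in force)+
    then show False using assms by (metis less_imp_le order_refl)
  qed
  then show ?thesis using that by blast
qed

text \<open>Charge a changed pixel \<open>(x, y)\<close> to a colour change \<open>(i, y)\<close>
  lying between \<open>x\<close> and \<open>f x\<close>. Then \<open>x\<close> crosses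
  \<open>i\<close>, so no colour change is charged more than \<open>M\<close> times.\<close>

lemma card_changed_by_displacement_le:
  fixes M :: real
  assumes f: "\<And>x. x \<in> {1..n} \<Longrightarrow> f x \<in> {1..n}"
    and M: "\<And>i. i \<in> {1..n} \<Longrightarrow> real (card (crossings {1..n} f i)) \<le> M"
  shows "real (card {(x, y) \<in> grid n. I (x, y) \<noteq> I (f x, y)})
           \<le> M * real (card (color_changes n I))"
proof -
  let ?A = "{(x, y) \<in> grid n. I (x, y) \<noteq> I (f x, y)}"
  let ?C = "\<lambda>(i, y). crossings {1..n} f i \<times> {y}"
  have fin: "finite (color_changes n I)"
    using color_changes_subset_grid finite_grid finite_subset by blast
  have "?A \<subseteq> (\<Union>p \<in> color_changes n I. ?C p)"
  proof
    fix p assume "p \<in> ?A"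
    then obtain x y where p: "p = (x, y)" "x \<in> {1..n}" "y \<in> {1..n}" "I (x, y) \<noteq> I (f x, y)"
      by (auto simp: grid_def)
    have "x < f x \<or> f x < x" using p(4) by (metis linorder_neqE_nat)
    then obtain i where i: "x \<le> i \<and> i < f x \<or> f x \<le> i \<and> i < x" "I (i, y) \<noteq> I (Suc i, y)"
    proof
      assume "x < f x"
      then show ?thesis
        using color_change_between[of x "f x" "\<lambda>i. I (i, y)"] p(4) that by blast
    next
      assume "f x < x"
      then show ?thesis
        using color_change_between[of "f x" x "\<lambda>i. I (i, y)"] p(4) that by metis
    qed
    then have "(i, y) \<in> color_changes n I" "x \<in> crossings {1..n} f i"
      using p f[OF p(2)] by (auto simp: color_changes_def crossings_def)
    then show "p \<in> (\<Union>p \<in> color_changes n I. ?C p)" using p(1) by force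
  qed
  then have "card ?A \<le> card (\<Union>p \<in> color_changes n I. ?C p)"
    using fin by (intro card_mono) (auto simp: crossings_def)
  also have "\<dots> \<le> (\<Sum>p \<in> color_changes n I. card (?C p))"
    using fin by (rule card_UN_le)
  finally have "real (card ?A) \<le> (\<Sum>p \<in> color_changes n I. real (card (?C p)))"
    unfolding of_nat_sum[symmetric] of_nat_le_iff .
  also have "\<dots> \<le> (\<Sum>p \<in> color_changes n I. M)"
    using M by (intro sum_mono) (auto simp: color_changes_def card_cartesian_product)
  also have "\<dots> = M * real (card (color_changes n I))" by simp
  finally show ?thesis .
qed

text \<open>Move from \<open>(x, y)\<close> to \<open>(f x, y)\<close> and then to
  \<open>(f x, g y)\<close>: a changed pixel changes in one of the two steps. Each step costs
  \<open>M\<close> times the colour changes of its direction, at most twice the boundary, giving the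
  factor 4.\<close>

lemma card_changed_by_row_column_displacement_le:
  fixes M :: real
  assumes f: "f permutes {1..n}" and g: "g permutes {1..n}"
    and Mf: "\<And>i. i \<in> {1..n} \<Longrightarrow> real (card (crossings {1..n} f i)) \<le> M"
    and Mg: "\<And>i. i \<in> {1..n} \<Longrightarrow> real (card (crossings {1..n} g i)) \<le> M"
    and M: "M \<ge> 0"
  shows "real (card {(x, y) \<in> grid n. I (x, y) \<noteq> I (f x, g y)}) \<le> 4 * M * real (card (boundary n I))"
proof -
  let ?J = "I \<circ> prod.swap"
  let ?A = "{(x, y) \<in> grid n. I (x, y) \<noteq> I (f x, y)}"
  let ?B = "{(y, x) \<in> grid n. ?J (y, x) \<noteq> ?J (g y, x)}"
  \<comment> \<open>The second step starts at \<open>(f x, y)\<close>, recorded in \<open>?B\<close>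
    as \<open>(y, f x)\<close>; \<open>inv f\<close> recovers the original pixel.\<close>
  let ?h = "\<lambda>(y, x). (inv f x, y)"
  have fin: "finite ?A" "finite ?B"
    by (rule finite_subset[OF _ finite_grid], auto)+
  have "{(x, y) \<in> grid n. I (x, y) \<noteq> I (f x, g y)} \<subseteq> ?A \<union> ?h ` ?B"
  proof
    fix p assume "p \<in> {(x, y) \<in> grid n. I (x, y) \<noteq> I (f x, g y)}"
    then obtain x y where p: "p = (x, y)" "(x, y) \<in> grid n" "I (x, y) \<noteq> I (f x, g y)" by auto
    show "p \<in> ?A \<union> ?h ` ?B"
    proof (cases "I (x, y) = I (f x, y)")
      case True
      have "(y, f x) \<in> ?B"
        using p True permutes_in_image[OF f, of x] by (auto simp: grid_def)
      moreover have "?h (y, f x) = p" using permutes_inverses(2)[OF f] p by simp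
      ultimately have "p \<in> ?h ` ?B" by (intro image_eqI[where x = "(y, f x)"]) simp_all
      then show ?thesis by (rule UnI2)
    qed (use p in auto)
  qed
  then have "card {(x, y) \<in> grid n. I (x, y) \<noteq> I (f x, g y)} \<le> card (?A \<union> ?h ` ?B)"
    using fin by (intro card_mono) simp_all
  also have "\<dots> \<le> card ?A + card (?h ` ?B)" by (rule card_Un_le)
  also have "\<dots> \<le> card ?A + card ?B"
    using fin by (intro add_left_mono card_image_le)
  finally have "real (card {(x, y) \<in> grid n. I (x, y) \<noteq> I (f x, g y)})
      \<le> real (card ?A) + real (card ?B)" by linarith
  also have "\<dots> \<le> M * real (card (color_changes n I)) + M * real (card (color_changes n ?J))"
    by (intro add_mono card_changed_by_displacement_le Mf Mg)
      (simp_all only: permutes_in_image[OF f] permutes_in_image[OF g])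
  also have "\<dots> \<le> M * real (2 * card (boundary n I)) + M * real (2 * card (boundary n I))"
  proof -
    have "card (boundary n ?J) = card (boundary n I)"
      by (simp add: boundary_swap card_image)
    then have "card (color_changes n ?J) \<le> 2 * card (boundary n I)"
      using card_color_changes_le[of n ?J] by simp
    then show ?thesis
      using card_color_changes_le[of n I] M by (intro add_mono mult_left_mono of_nat_mono)
  qed
  finally show ?thesis by simp
qed

section \<open>Permutations between image graphs\<close>

lemma image_graph_doubleton:
  assumes "a \<in> {1..2 * n}" "b \<in> {1..2 * n}" "a < b"
  shows "image_graph n I {a, b} = (if a \<le> n \<and> n < b then Pixel (I (a, b - n)) else Special)"
  using assms by (auto simp: image_graph_def pairs_def)

lemma image_graph_eq_Special_iff:
  assumes "a \<in> {1..2 * n}" "b \<in> {1..2 * n}" "a \<noteq> b"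
  shows "image_graph n I {a, b} = Special \<longleftrightarrow> (a \<le> n \<longleftrightarrow> b \<le> n)"
proof (cases "a < b")
  case True
  then show ?thesis using assms by (auto simp: image_graph_doubleton)
next
  case False
  then have "b < a" using assms(3) by simp
  then show ?thesis using assms image_graph_doubleton[of b n a I]
    by (auto simp: insert_commute)
qed

text \<open>Two vertices are on the same side exactly when their pair is \<open>Special\<close>, and
  the colour of \<open>{a, b}\<close> in the new graph is that of \<open>{s a, s b}\<close> in the
  old one.\<close>

lemma image_graph_permutation_sides:
  assumes s: "s permutes {1..2 * n}"
    and eq: "image_graph n I' = (\<lambda>e. image_graph n I (s ` e))"
    and a: "a \<in> {1..2 * n}" and b: "b \<in> {1..2 * n}"
  shows "(s a \<le> n \<longleftrightarrow> s b \<le> n) \<longleftrightarrow> (a \<le> n \<longleftrightarrow> b \<le> n)"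
proof (cases "a = b")
  case False
  have "s a \<in> {1..2 * n}" "s b \<in> {1..2 * n}" "s a \<noteq> s b"
    using a b False by (simp_all only: permutes_in_image[OF s] inj_eq[OF permutes_inj[OF s]] not_False_eq_True)
  then show ?thesis
    using fun_cong[OF eq, of "{a, b}"] image_graph_eq_Special_iff[OF a b False, of I']
      image_graph_eq_Special_iff[of "s a" n "s b" I] by simp
qed simp

text \<open>With fewer than n^2 moves the permutation must preserve rows and columns, hence splits
  into a row and a column permutation. The factor 8 is 4 from the two-step displacement times 2 from
  the crossing bound.\<close>

lemma card_changed_by_basic_moves_le:
  assumes n: "n \<ge> 1"
    and moves: "(image_graph n I, image_graph n I') \<in> basic_move (2 * n) ^^ k"
    and k: "k < n\<^sup>2"
  shows "real (card {p \<in> grid n. I' p \<noteq> I p}) \<le> 8 * sqrt k * real (card (boundary n I))"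
proof -
  obtain s where s: "s permutes {1..2 * n}" and fin: "finite (inversions s)"
    and inv: "card (inversions s) \<le> k" and eq: "image_graph n I' = (\<lambda>e. image_graph n I (s ` e))"
    using moves by (rule basic_moves_permutation)
  note sides = image_graph_permutation_sides[OF s eq]
  note in_range = permutes_in_image[OF s]
  \<comment> \<open>If vertex 1 became a column, so would all rows; then n points would jump upwards
    over the threshold \<open>n\<close>, forcing n^2 inversions.\<close>
  have s1: "s 1 \<le> n"
  proof (rule ccontr)
    assume "\<not> s 1 \<le> n"
    then have "n < s x" if "x \<in> {1..n}" for x
      using sides[of 1 x] that n by auto
    then have "{x \<in> {1..2 * n}. x \<le> n \<and> n < s x} = {1..n}" by auto
    then have "n\<^sup>2 \<le> card (inversions s)"
      using crossings_up_squared_le_inversions[OF s _ fin, of n] by simp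
    then show False using inv k by simp
  qed
  have side: "s x \<le> n \<longleftrightarrow> x \<le> n" if "x \<in> {1..2 * n}" for x
    using sides[of 1 x] that n s1 by auto
  define f where "f x = (if x \<in> {1..n} then s x else x)" for x
  define g where "g y = (if y \<in> {1..n} then s (n + y) - n else y)" for y
  have f: "f permutes {1..n}"
  proof (rule bij_imp_permutes)
    have "inj_on f {1..n}"
      using permutes_inj_on[OF s, of "{1..n}"] by (subst inj_on_cong[where g = s]) (simp_all add: f_def)
    moreover have "f x \<in> {1..n}" if "x \<in> {1..n}" for x
      using side[of x] in_range[of x] that by (auto simp: f_def)
    then have "f ` {1..n} \<subseteq> {1..n}" by (rule image_subsetI)
    ultimately show "bij_betw f {1..n} {1..n}"
      by (intro bij_betw_imageI endo_inj_surj) simp_all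
  qed (auto simp: f_def)
  have column: "n < s (n + y)" "s (n + y) \<le> 2 * n" if "y \<in> {1..n}" for y
    using side[of "n + y"] in_range[of "n + y"] that by auto
  have g: "g permutes {1..n}"
  proof (rule bij_imp_permutes)
    have "inj_on g {1..n}"
    proof (rule inj_onI)
      fix x y assume xy: "x \<in> {1..n}" "y \<in> {1..n}" "g x = g y"
      then have "s (n + x) = s (n + y)" using column[of x] column[of y] by (simp add: g_def)
      then show "x = y" by (simp add: inj_eq[OF permutes_inj[OF s]])
    qed
    moreover have "g y \<in> {1..n}" if "y \<in> {1..n}" for y
      using column[OF that] that by (auto simp: g_def)
    then have "g ` {1..n} \<subseteq> {1..n}" by (rule image_subsetI)
    ultimately show "bij_betw g {1..n} {1..n}"
      by (intro bij_betw_imageI endo_inj_surj) simp_all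
  qed (auto simp: g_def)
  have I': "I' (x, y) = I (f x, g y)" if xy: "x \<in> {1..n}" "y \<in> {1..n}" for x y
  proof -
    have sx: "s x \<in> {1..2 * n}" "s x \<le> n" using in_range[of x] side[of x] xy by auto
    have "image_graph n I' {x, n + y} = image_graph n I {s x, s (n + y)}"
      using fun_cong[OF eq, of "{x, n + y}"] by simp
    moreover have "image_graph n I' {x, n + y} = Pixel (I' (x, y))"
      using xy by (subst image_graph_doubleton) auto
    moreover have "image_graph n I {s x, s (n + y)} = Pixel (I (s x, s (n + y) - n))"
      using sx column[OF xy(2)] by (subst image_graph_doubleton) auto
    ultimately show ?thesis using xy by (simp add: f_def g_def)
  qed
  have M: "real (card (crossings {1..2 * n} s i)) \<le> 2 * sqrt k" for i
    using s fin inv by (intro card_crossings_le) auto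
  have Mf: "real (card (crossings {1..n} f i)) \<le> 2 * sqrt k" for i
  proof -
    have "crossings {1..n} f i \<subseteq> crossings {1..2 * n} s i" by (auto simp: crossings_def f_def)
    then have "card (crossings {1..n} f i) \<le> card (crossings {1..2 * n} s i)"
      by (intro card_mono) (auto simp: crossings_def)
    then show ?thesis using M[of i] by linarith
  qed
  have Mg: "real (card (crossings {1..n} g i)) \<le> 2 * sqrt k" for i
  proof -
    \<comment> \<open>Column \<open>y\<close> is vertex \<open>n + y\<close>, so a crossing of
      \<open>i\<close> by \<open>g\<close> is a crossing of the shifted threshold
      \<open>n + i\<close> by \<open>s\<close>.\<close>
    have "n + y \<in> crossings {1..2 * n} s (n + i)" if "y \<in> crossings {1..n} g i" for y
      using that column[of y] by (auto simp: crossings_def g_def)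
    then have "(+) n ` crossings {1..n} g i \<subseteq> crossings {1..2 * n} s (n + i)"
      by (rule image_subsetI)
    then have "card ((+) n ` crossings {1..n} g i) \<le> card (crossings {1..2 * n} s (n + i))"
      by (intro card_mono) (auto simp: crossings_def)
    then have "card (crossings {1..n} g i) \<le> card (crossings {1..2 * n} s (n + i))"
      by (simp add: card_image)
    then show ?thesis using M[of "n + i"] by linarith
  qed
  have "{p \<in> grid n. I' p \<noteq> I p} = {(x, y) \<in> grid n. I (x, y) \<noteq> I (f x, g y)}"
    using I' by (auto simp: grid_def)
  then show ?thesis
    using card_changed_by_row_column_displacement_le[OF f g Mf Mg, of I] by simp
qed

section \<open>From earthmover distance to Hamming distance\<close>

text \<open>A finite bound on \<open>d_e\<close> excludes the empty infimum, and a nonempty set of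
  \<open>enat\<close> values attains its infimum, so a shortest sequence of moves exists.\<close>

lemma d_e_le_obtain_moves:
  assumes n: "n \<ge> 1" and d: "d_e n I J \<le> ereal r"
  obtains k where "(image_graph n I, image_graph n J) \<in> basic_move (2 * n) ^^ k"
    "real k \<le> r * real ((2 * n) choose 2)"
proof -
  let ?K = "{k. (image_graph n I, image_graph n J) \<in> basic_move (2 * n) ^^ k}"
  have pos: "real ((2 * n) choose 2) > 0" using n by (simp add: zero_less_binomial)
  have "enat ` ?K \<noteq> {}"
  proof
    assume "enat ` ?K = {}"
    then have "D_e n I J = \<infinity>" unfolding D_e_def by (simp only: Inf_empty top_enat_def)
    then have "d_e n I J = \<infinity>" using pos by (simp add: d_e_def)
    then show False using d by simp
  qed
  then obtain m where "m \<in> enat ` ?K" by blast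
  then have "D_e n I J \<in> enat ` ?K" unfolding D_e_def by (rule wellorder_InfI)
  then obtain k where k: "k \<in> ?K" "D_e n I J = enat k" by auto
  have "real k / real ((2 * n) choose 2) \<le> r" using d k(2) pos by (simp add: d_e_def)
  then have "real k \<le> r * real ((2 * n) choose 2)" using pos by (simp add: divide_le_eq)
  then show ?thesis using that k(1) by blast
qed

theorem theorem5:
  "\<exists>\<alpha>::real. \<alpha> > 0 \<and>
     (\<forall>(c::real) (P::property).
        c \<ge> 1 \<and> is_property P \<and> property_sparse_boundary c P \<longrightarrow>
        earthmover_resilient (\<lambda>\<epsilon>. \<alpha> * \<epsilon>\<^sup>2 / c\<^sup>2) P)"
proof (intro exI[of _ "1/128"] conjI allI impI)
  fix c :: real and P :: property
  assume "c \<ge> 1 \<and> is_property P \<and> property_sparse_boundary c P"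
  then have c: "c \<ge> 1" and P: "property_sparse_boundary c P" by auto
  have "close_to \<epsilon> n I' P"
    if \<epsilon>: "0 < \<epsilon>" "\<epsilon> < 1" and n: "n \<ge> 1" and I: "I \<in> P n"
      and d: "d_e n I I' \<le> ereal (1/128 * \<epsilon>\<^sup>2 / c\<^sup>2)" for \<epsilon> n I I'
  proof -
    obtain k where k: "(image_graph n I, image_graph n I') \<in> basic_move (2 * n) ^^ k"
      "real k \<le> 1/128 * \<epsilon>\<^sup>2 / c\<^sup>2 * real ((2 * n) choose 2)"
      using d_e_le_obtain_moves[OF n d] by blast
    \<comment> \<open>Origin of \<open>1/128\<close>: the final estimate 8 sqrt(k) * c n \<le>
      \<epsilon> n^2 requires k \<le> (\<epsilon> n / (8 c))^2, and the binomial coefficient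
      contributes the factor 2 in 2/128 = 1/64.\<close>
    have "(2 * n) choose 2 \<le> 2 * n\<^sup>2"
      by (simp add: choose_two power2_eq_square diff_mult_distrib2)
    then have "real ((2 * n) choose 2) \<le> 2 * (real n)\<^sup>2"
      by (metis of_nat_le_iff of_nat_mult of_nat_numeral of_nat_power)
    then have "real k \<le> 1/128 * \<epsilon>\<^sup>2 / c\<^sup>2 * (2 * (real n)\<^sup>2)"
      using k(2) by (meson divide_nonneg_nonneg mult_left_mono mult_nonneg_nonneg order_trans
          zero_le_divide_1_iff zero_le_numeral zero_le_power2)
    also have "\<dots> = (\<epsilon> * n / (8 * c))\<^sup>2" by (simp add: power_divide power_mult_distrib)
    finally have k_le: "real k \<le> (\<epsilon> * n / (8 * c))\<^sup>2" .
    then have sqrt_k: "sqrt k \<le> \<epsilon> * n / (8 * c)"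
      using \<epsilon> c by (intro real_le_lsqrt) auto
    \<comment> \<open>The bounds \<epsilon> < 1 and c \<ge> 1 keep \<open>k\<close> below n^2, which
      rules out exchanging rows and columns.\<close>
    have "\<epsilon> * n / (8 * c) < n"
      using \<epsilon> c n by (simp add: divide_less_eq)
    then have "(\<epsilon> * n / (8 * c))\<^sup>2 < (real n)\<^sup>2"
      using \<epsilon> c by (intro power_strict_mono) auto
    then have "k < n\<^sup>2" using k_le by (metis le_less_trans of_nat_less_iff of_nat_power)
    then have "real (card {p \<in> grid n. I' p \<noteq> I p}) \<le> 8 * sqrt k * real (card (boundary n I))"
      using n k(1) by (intro card_changed_by_basic_moves_le)
    also have "\<dots> \<le> 8 * (\<epsilon> * n / (8 * c)) * (c * n)"
      using sqrt_k P n I \<epsilon> c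
      by (intro mult_mono) (auto simp: property_sparse_boundary_def sparse_boundary_def)
    also have "\<dots> = \<epsilon> * (real n)\<^sup>2" using c by (simp add: power2_eq_square)
    finally have "hamming_dist n I' I \<le> \<epsilon>"
      using n by (simp add: hamming_dist_def divide_le_eq)
    then show ?thesis using I by (auto simp: close_to_def)
  qed
  then show "earthmover_resilient (\<lambda>\<epsilon>. 1/128 * \<epsilon>\<^sup>2 / c\<^sup>2) P"
    unfolding earthmover_resilient_def by blast
qed simp

end
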